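(* For every sequence $m=(m(n))_{n\in\mathbb{N}}$ of positive integers with $m(n)\le \alpha(n)$ for all $n$, we have $$\mathbb{E}_{n,\alpha}[C_{m(n)}]\sim \mu_{m(n)}(n)\qquad\text{as } n\to\infty .$$ Furthermore, for large $n$, $$\frac{1}{m(n)}\log\big(m(n)\,\mu_{m(n)}(n)\big)=\log x_{n,\alpha}=\frac{1}{\alpha(n)}\left(\log\frac{n}{\alpha(n)}+\log\log\frac{n}{\alpha(n)}+\mathcal{O}\left(\frac{\log\log n}{\log n}\right)\right).$$
   Context: Fix $a_1,a_2\in(0,1)$ and a sequence $\alpha=(\alpha(n))_{n\in\mathbb{N}}$ with $n^{a_1}\le\alpha(n)\le n^{a_2}$. Sums $\sum_{j=1}^{\alpha(n)}$ run over the integers $j$ with $1\le j\le\alpha(n)$. $S_{n,\alpha}$ is the set of permutations of $\{1,\dots,n\}$ all of whose cycles have length at most $\alpha(n)$; $\mathbb{P}_{n,\alpha}$ is the uniform probability measure on $S_{n,\alpha}$ and $\mathbb{E}_{n,\alpha}$ its expectation. $C_m=C_m(\sigma)$ is the number of cycles of length $m$ in the permutation $\sigma$. $x_{n,\alpha}$ is the unique positive solution of $n=\sum_{j=1}^{\alpha(n)}x_{n,\alpha}^{j}$, and $\mu_m(n):=x_{n,\alpha}^m/m$. $a_n\sim b_n$ means $a_n/b_n\to1$. *)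

theory Defs
  imports
    "HOL-Probability.Probability_Mass_Function"
    "HOL-Combinatorics.Orbits"
    "HOL-Library.Landau_Symbols"
begin

text \<open>
  The sequence \<open>\<alpha>\<close> is real-valued; all notions below depend on it only through
  the number \<open>b = \<alpha> n\<close>.
\<close>

definition perm_cycles :: "nat \<Rightarrow> (nat \<Rightarrow> nat) \<Rightarrow> nat set set" where
  "perm_cycles n \<sigma> = orbit \<sigma> ` {1..n}"

definition cycle_count :: "nat \<Rightarrow> nat \<Rightarrow> (nat \<Rightarrow> nat) \<Rightarrow> nat" where
  "cycle_count n m \<sigma> = card {c \<in> perm_cycles n \<sigma>. card c = m}"

definition bounded_cycle_perms :: "nat \<Rightarrow> real \<Rightarrow> (nat \<Rightarrow> nat) set" where
  "bounded_cycle_perms n b =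
     {\<sigma>. \<sigma> permutes {1..n} \<and> (\<forall>c\<in>perm_cycles n \<sigma>. real (card c) \<le> b)}"

lemma finite_bounded_cycle_perms: "finite (bounded_cycle_perms n b)"
  by (rule finite_subset[OF _ finite_permutations[of "{1..n}"]])
     (auto simp: bounded_cycle_perms_def)

lemma id_in_bounded_cycle_perms:
  assumes "b \<ge> 1"
  shows "id \<in> bounded_cycle_perms n b"
proof -
  have "orbit id x = {x}" for x :: nat
    by (auto simp: orbit_altdef)
  with assms show ?thesis
    by (auto simp: bounded_cycle_perms_def perm_cycles_def permutes_id)
qed

text \<open>
  For \<open>b \<ge> 1\<close> the set is finite and nonempty by the two lemmas above, so
  \<^const>\<open>pmf_of_set\<close> really is the uniform distribution on it.
\<close>
definition bounded_cycle_pmf :: "nat \<Rightarrow> real \<Rightarrow> (nat \<Rightarrow> nat) pmf" where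
  "bounded_cycle_pmf n b = pmf_of_set (bounded_cycle_perms n b)"

definition saddle_point :: "nat \<Rightarrow> real \<Rightarrow> real" where
  "saddle_point n b =
     (THE x. x > 0 \<and> real n = (\<Sum>j | 1 \<le> j \<and> real j \<le> b. x ^ j))"

lemma saddle_point_unique:
  assumes n: "n \<ge> 1" and b: "b \<ge> 1"
  shows "\<exists>!x::real. x > 0 \<and> real n = (\<Sum>j | 1 \<le> j \<and> real j \<le> b. x ^ j)"
proof -
  define J where "J = {j::nat. 1 \<le> j \<and> real j \<le> b}"
  have "J \<subseteq> {..nat \<lceil>b\<rceil>}"
    by (auto simp: J_def) linarith
  then have fin: "finite J" by (rule finite_subset) simp
  have J1: "1 \<in> J" and Jpos: "\<And>j. j \<in> J \<Longrightarrow> j \<ge> 1" using b by (auto simp: J_def)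
  define f where "f = (\<lambda>x::real. \<Sum>j\<in>J. x ^ j)"
  have mono: "f x < f y" if "0 \<le> x" "x < y" for x y
    unfolding f_def
  proof (rule sum_strict_mono[OF fin])
    show "x ^ j < y ^ j" if "j \<in> J" for j
      using \<open>0 \<le> x\<close> \<open>x < y\<close> Jpos[OF that] by (intro power_strict_mono) auto
  qed (use J1 in auto)
  have f0: "f 0 = 0"
    unfolding f_def by (intro sum.neutral) (auto dest: Jpos)
  have "f (real n) \<ge> real n ^ 1"
    unfolding f_def by (rule member_le_sum[OF J1 _ fin]) auto
  moreover have "continuous_on {0..real n} f"
    unfolding f_def by (intro continuous_intros)
  ultimately obtain x where x: "0 \<le> x" "f x = real n"
    using IVT'[of f 0 "real n" "real n"] f0 by auto
  with f0 n have "x > 0" by (cases "x = 0") auto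
  show ?thesis
    unfolding J_def[symmetric]
  proof (rule ex1I[of _ x])
    show "x > 0 \<and> real n = (\<Sum>j\<in>J. x ^ j)"
      using \<open>x > 0\<close> x by (simp add: f_def)
    fix y :: real assume "y > 0 \<and> real n = (\<Sum>j\<in>J. y ^ j)"
    then have "y > 0" "f y = real n" by (auto simp: f_def)
    with x mono[of x y] mono[of y x] show "y = x" by linarith
  qed
qed

definition cycle_mean :: "nat \<Rightarrow> real \<Rightarrow> nat \<Rightarrow> real" where
  "cycle_mean n b m = saddle_point n b ^ m / real m"

end

theory Submission
  imports Defs "HOL-Real_Asymp.Real_Asymp"
begin

text \<open>
  Fix an integer \<open>b\<close> and let \<open>h k\<close> be \<open>1 / k!\<close> times the number of permutations of \<open>k\<close> points whose
  cycles all have length at most \<open>b\<close>. A prescribed set of \<open>m\<close> points can be made into a cycle in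
  \<open>(m - 1)!\<close> ways, and what remains is a permutation of the other points; hence the expected number
  of \<open>m\<close>-cycles is \<open>h (n - m) / (m * h n)\<close> (\<open>expectation_cycle_count\<close>), and the first claim says
  that \<open>h (n - m) / h n\<close> is asymptotic to \<open>x ^ m\<close>, uniformly in \<open>m \<le> b\<close>.

  The usual route to this is the saddle point method. The proof below replaces it by an elementary
  argument. Counting points by the length of their cycle gives \<open>k * h k = h (k - 1) + \<dots> + h (k - b)\<close>.
  From this recursion alone one shows that \<open>h\<close> is log-concave (\<open>q_Suc_le\<close>), that is, the
  ratios \<open>R k = h (k - 1) / h k\<close> increase with \<open>k\<close>. Divided by \<open>h k\<close>, the recursion expresses
  \<open>k\<close> as a sum over \<open>j \<le> b\<close> of products of \<open>j\<close> consecutive ratios; monotonicity turns this into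
  inequalities for the power sum \<open>f x = x + \<dots> + x ^ b\<close>, namely \<open>k \<le> f (R k) \<le> k + b - 1\<close>
  (\<open>sum_powers_inverse_q_ge\<close>, \<open>sum_powers_inverse_q_le\<close>). The saddle point solves \<open>f x = n\<close>, so
  every ratio with index within \<open>b\<close> of \<open>n\<close> is a solution of the saddle point equation up to an
  error of size \<open>b\<close> on the side of \<open>n\<close>. By Chebyshev's sum inequality \<open>ln f\<close> grows at rate at
  least \<open>b / 2\<close> in \<open>ln x\<close> (\<open>power_ratio_le_exp\<close>), so even the \<open>b\<close>-th power of such a ratio
  agrees with \<open>x ^ b\<close> up to a factor \<open>exp (O (b / n))\<close>. As \<open>b / n\<close> tends to \<open>0\<close>, the first claim
  follows (\<open>density_ratio_bounds\<close>).

  For the second claim, put \<open>W = \<alpha> n * ln x\<close> and \<open>U = n / \<alpha> n\<close>. Summing the geometric series turns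
  \<open>f x = n\<close> into \<open>W = ln U + ln W\<close> up to an error that is polynomially small in \<open>n\<close>
  (\<open>saddle_log_bounds\<close>), and one substitution of this relation into itself gives
  \<open>W = ln U + ln (ln U) + O (ln (ln n) / ln n)\<close> (\<open>log_fixed_point_expansion\<close>).
\<close>

section \<open>Splitting off a cycle\<close>

definition short_cycle_perms :: "'a set \<Rightarrow> nat \<Rightarrow> ('a \<Rightarrow> 'a) set" where
  "short_cycle_perms A b = {\<sigma>. \<sigma> permutes A \<and> (\<forall>x\<in>A. card (orbit \<sigma> x) \<le> b)}"

definition full_cycles :: "'a set \<Rightarrow> ('a \<Rightarrow> 'a) set" where
  "full_cycles C = {\<tau>. \<tau> permutes C \<and> cyclic_on \<tau> C}"

lemma finite_short_cycle_perms: "finite A \<Longrightarrow> finite (short_cycle_perms A b)"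
  by (rule finite_subset[OF _ finite_permutations[of A]]) (auto simp: short_cycle_perms_def)

lemma orbit_comp_disjoint:
  assumes \<tau>: "\<tau> permutes C" and \<rho>: "\<rho> permutes D" and disj: "C \<inter> D = {}"
  shows "x \<in> C \<Longrightarrow> orbit (\<tau> \<circ> \<rho>) x = orbit \<tau> x"
    and "x \<in> D \<Longrightarrow> orbit (\<tau> \<circ> \<rho>) x = orbit \<rho> x"
proof -
  have C: "(\<tau> \<circ> \<rho>) y = \<tau> y" if "y \<in> C" for y
    using that disj permutes_not_in[OF \<rho>, of y] by (metis comp_apply disjoint_iff)
  have D: "(\<tau> \<circ> \<rho>) y = \<rho> y" if "y \<in> D" for y
    using that disj permutes_in_image[OF \<rho>, of y] permutes_not_in[OF \<tau>, of "\<rho> y"] by auto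
  show "x \<in> C \<Longrightarrow> orbit (\<tau> \<circ> \<rho>) x = orbit \<tau> x"
    by (rule sym, rule orbit_cong0[of _ C]) (auto simp: C[unfolded o_def] permutes_in_image[OF \<tau>])
  show "x \<in> D \<Longrightarrow> orbit (\<tau> \<circ> \<rho>) x = orbit \<rho> x"
    by (rule sym, rule orbit_cong0[of _ D]) (auto simp: D[unfolded o_def] permutes_in_image[OF \<rho>])
qed

text \<open>
  The restriction to the complement of a cycle is treated by \<open>perm_restrict_diff_cyclic\<close>; this is the
  companion statement for the cycle itself.
\<close>
lemma perm_restrict_cyclic_permutes:
  assumes "\<sigma> permutes A" "cyclic_on \<sigma> C"
  shows "perm_restrict \<sigma> C permutes C"
proof (rule bij_imp_permutes)
  have "inj_on \<sigma> C" using assms(1) permutes_inj inj_on_subset by blast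
  moreover have "\<sigma> ` C \<subseteq> C" using cyclic_on_inI[OF assms(2)] by auto
  ultimately have "bij_betw \<sigma> C C"
    unfolding bij_betw_def using endo_inj_surj finite_cyclic_on[OF assms(2)] by blast
  then show "bij_betw (perm_restrict \<sigma> C) C C"
    by (simp cong: bij_betw_cong add: perm_restrict_simps)
qed (simp add: perm_restrict_simps)

text \<open>
  A permutation with \<open>C\<close> as a cycle is determined by its restrictions to \<open>C\<close> and to \<open>A - C\<close>, and
  composing two such restrictions leaves all orbits unchanged, so that the length condition carries
  over in both directions.
\<close>
lemma bij_betw_cycle_decomposition:
  assumes "C \<subseteq> A" "card C \<le> b"
  shows "bij_betw (\<lambda>(\<tau>, \<rho>). \<tau> \<circ> \<rho>) (full_cycles C \<times> short_cycle_perms (A - C) b)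
           {\<sigma> \<in> short_cycle_perms A b. cyclic_on \<sigma> C}"
proof (rule bij_betw_byWitness[where f' = "\<lambda>\<sigma>. (perm_restrict \<sigma> C, perm_restrict \<sigma> (A - C))"])
  have disj: "C \<inter> (A - C) = {}" by auto
  have comp: "(\<tau> \<circ> \<rho>) x = (if x \<in> C then \<tau> x else \<rho> x)"
    if "\<tau> permutes C" "\<rho> permutes (A - C)" for \<tau> \<rho> x
  proof (cases "x \<in> A - C")
    case True
    then have "\<rho> x \<in> A - C" using that(2) by (simp only: permutes_in_image)
    then show ?thesis using True that(1) by (auto simp: permutes_not_in)
  next
    case False
    then show ?thesis using that by (auto simp: permutes_not_in)
  qed
  show "\<forall>p\<in>full_cycles C \<times> short_cycle_perms (A - C) b.
      (\<lambda>\<sigma>. (perm_restrict \<sigma> C, perm_restrict \<sigma> (A - C))) (case p of (\<tau>, \<rho>) \<Rightarrow> \<tau> \<circ> \<rho>) = p"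
    by (auto simp: full_cycles_def short_cycle_perms_def perm_restrict_def comp[unfolded o_def]
        fun_eq_iff permutes_not_in)
  show "\<forall>\<sigma>\<in>{\<sigma> \<in> short_cycle_perms A b. cyclic_on \<sigma> C}.
      (case (perm_restrict \<sigma> C, perm_restrict \<sigma> (A - C)) of (\<tau>, \<rho>) \<Rightarrow> \<tau> \<circ> \<rho>) = \<sigma>"
  proof
    fix \<sigma> assume "\<sigma> \<in> {\<sigma> \<in> short_cycle_perms A b. cyclic_on \<sigma> C}"
    then have \<sigma>: "\<sigma> permutes A" "cyclic_on \<sigma> C" by (auto simp: short_cycle_perms_def)
    have "perm_restrict \<sigma> (A - C) permutes (A - C)"
      by (rule perm_restrict_diff_cyclic[OF \<sigma>])
    moreover have "perm_restrict \<sigma> C permutes C"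
      by (rule perm_restrict_cyclic_permutes[OF \<sigma>])
    ultimately have "(perm_restrict \<sigma> C \<circ> perm_restrict \<sigma> (A - C)) x = \<sigma> x" for x
      using \<sigma>(1) by (subst comp) (auto simp: perm_restrict_def permutes_not_in)
    then show "(case (perm_restrict \<sigma> C, perm_restrict \<sigma> (A - C)) of (\<tau>, \<rho>) \<Rightarrow> \<tau> \<circ> \<rho>) = \<sigma>"
      by (simp add: fun_eq_iff)
  qed
  show "(\<lambda>(\<tau>, \<rho>). \<tau> \<circ> \<rho>) ` (full_cycles C \<times> short_cycle_perms (A - C) b)
      \<subseteq> {\<sigma> \<in> short_cycle_perms A b. cyclic_on \<sigma> C}"
  proof safe
    fix \<tau> \<rho> assume \<tau>: "\<tau> \<in> full_cycles C" and \<rho>: "\<rho> \<in> short_cycle_perms (A - C) b"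
    then have p: "\<tau> permutes C" "\<rho> permutes (A - C)" "cyclic_on \<tau> C"
      by (auto simp: full_cycles_def short_cycle_perms_def)
    note orb = orbit_comp_disjoint[OF p(1,2) disj]
    have "\<tau> \<circ> \<rho> permutes A"
      using p assms(1) by (intro permutes_compose) (auto intro: permutes_subset)
    moreover have "card (orbit (\<tau> \<circ> \<rho>) x) \<le> b" if "x \<in> A" for x
    proof (cases "x \<in> C")
      case True
      then show ?thesis using orb(1)[of x] assms(2) orbit_cyclic_eq3[OF p(3), of x] by simp
    next
      case False
      then show ?thesis using orb(2)[of x] that \<rho> by (auto simp: short_cycle_perms_def)
    qed
    ultimately show "\<tau> \<circ> \<rho> \<in> short_cycle_perms A b" by (auto simp: short_cycle_perms_def)
    show "cyclic_on (\<tau> \<circ> \<rho>) C"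
      using p(3) orb(1) by (auto simp: cyclic_on_def)
  qed
  show "(\<lambda>\<sigma>. (perm_restrict \<sigma> C, perm_restrict \<sigma> (A - C))) ` {\<sigma> \<in> short_cycle_perms A b. cyclic_on \<sigma> C}
      \<subseteq> full_cycles C \<times> short_cycle_perms (A - C) b"
  proof safe
    fix \<sigma> assume \<sigma>: "\<sigma> \<in> short_cycle_perms A b" and cyc: "cyclic_on \<sigma> C"
    then have perm: "\<sigma> permutes A" by (simp add: short_cycle_perms_def)
    show "perm_restrict \<sigma> C \<in> full_cycles C"
      using perm_restrict_cyclic_permutes[OF perm cyc] cyc
      by (simp add: full_cycles_def cyclic_on_perm_restrict)
    have inA: "\<sigma> x \<in> A - C" if "x \<in> A - C" for x
      using that perm cyclic_on_f_in[OF perm cyc, of x] by (auto simp: permutes_in_image)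
    have "orbit (perm_restrict \<sigma> (A - C)) x = orbit \<sigma> x" if "x \<in> A - C" for x
      using that inA by (intro orbit_cong0[of _ "A - C"]) (auto simp: perm_restrict_simps)
    then show "perm_restrict \<sigma> (A - C) \<in> short_cycle_perms (A - C) b"
      using perm_restrict_diff_cyclic[OF perm cyc] \<sigma> by (auto simp: short_cycle_perms_def)
  qed
qed

lemma card_perms_with_cycle:
  assumes "C \<subseteq> A" "card C \<le> b"
  shows "card {\<sigma> \<in> short_cycle_perms A b. cyclic_on \<sigma> C}
       = card (full_cycles C) * card (short_cycle_perms (A - C) b)"
  using bij_betw_same_card[OF bij_betw_cycle_decomposition[OF assms]] by (simp add: card_cartesian_product)

section \<open>Counting permutations by the cycle of a point\<close>

lemma cyclic_subsets_eq_orbits: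
  assumes "\<sigma> permutes A" "finite A"
  shows "{C. C \<subseteq> A \<and> cyclic_on \<sigma> C} = orbit \<sigma> ` A"
proof safe
  fix C assume "C \<subseteq> A" "cyclic_on \<sigma> C"
  then show "C \<in> orbit \<sigma> ` A" by (auto simp: cyclic_on_def)
next
  fix x y assume "x \<in> A" "y \<in> orbit \<sigma> x"
  then show "y \<in> A" using permutes_orbit_subset[OF assms(1)] by auto
qed (rule cyclic_on_orbit[OF assms])

lemma sum_card_cycles:
  assumes "\<sigma> permutes A" "finite A"
  shows "(\<Sum>C | C \<subseteq> A \<and> cyclic_on \<sigma> C. card C) = card A"
proof -
  let ?P = "{C. C \<subseteq> A \<and> cyclic_on \<sigma> C}"
  have self: "x \<in> orbit \<sigma> x" for x
    using assms by (intro permutation_self_in_orbit) (auto simp: permutation_permutes)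
  have "\<Union>?P = A"
    using self permutes_orbit_subset[OF assms(1)] unfolding cyclic_subsets_eq_orbits[OF assms] by auto
  moreover have "card (\<Union>?P) = sum card ?P"
  proof (rule card_Union_disjoint)
    show "pairwise disjnt ?P"
      by (auto simp: pairwise_def disjnt_def dest: orbit_cyclic_eq3)
  qed (auto intro: finite_subset[OF _ assms(2)])
  ultimately show ?thesis by simp
qed

text \<open>
  Both sides count pairs of a permutation and a point of \<open>A\<close>: on the right the point is counted
  through the cycle \<open>C\<close> that contains it.
\<close>
lemma card_mult_card_short_cycle_perms:
  assumes "finite A"
  shows "card A * card (short_cycle_perms A b)
       = (\<Sum>C | C \<subseteq> A \<and> C \<noteq> {} \<and> card C \<le> b.
            card C * (card (full_cycles C) * card (short_cycle_perms (A - C) b)))"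
proof -
  let ?S = "short_cycle_perms A b"
  note fin = finite_short_cycle_perms[OF assms, of b]
  have "card A * card ?S = (\<Sum>\<sigma>\<in>?S. \<Sum>C | C \<subseteq> A \<and> cyclic_on \<sigma> C. card C)"
    using sum_card_cycles[OF _ assms] by (simp add: short_cycle_perms_def)
  also have "\<dots> = (\<Sum>\<sigma>\<in>?S. \<Sum>C\<in>Pow A. if cyclic_on \<sigma> C then card C else 0)"
    using assms by (intro sum.cong[OF refl, of ?S]) (simp add: sum.inter_filter[symmetric])
  also have "\<dots> = (\<Sum>C\<in>Pow A. \<Sum>\<sigma>\<in>?S. if cyclic_on \<sigma> C then card C else 0)"
    by (rule sum.swap)
  also have "\<dots> = (\<Sum>C\<in>Pow A. card C * card {\<sigma> \<in> ?S. cyclic_on \<sigma> C})"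
    using fin by (intro sum.cong refl) (simp add: sum.inter_filter[symmetric])
  also have "\<dots> = (\<Sum>C | C \<subseteq> A \<and> C \<noteq> {} \<and> card C \<le> b. card C * card {\<sigma> \<in> ?S. cyclic_on \<sigma> C})"
  proof (rule sum.mono_neutral_right)
    show "\<forall>C\<in>Pow A - {C. C \<subseteq> A \<and> C \<noteq> {} \<and> card C \<le> b}. card C * card {\<sigma> \<in> ?S. cyclic_on \<sigma> C} = 0"
    proof
      fix C assume C: "C \<in> Pow A - {C. C \<subseteq> A \<and> C \<noteq> {} \<and> card C \<le> b}"
      show "card C * card {\<sigma> \<in> ?S. cyclic_on \<sigma> C} = 0"
      proof (cases "C = {}")
        case False
        with C have "C \<subseteq> A" "\<not> card C \<le> b" by auto
        then have none: "{\<sigma> \<in> ?S. cyclic_on \<sigma> C} = {}"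
          unfolding short_cycle_perms_def cyclic_on_def by auto
        show ?thesis unfolding none by simp
      qed simp
    qed
  qed (use assms in auto)
  also have "\<dots> = (\<Sum>C | C \<subseteq> A \<and> C \<noteq> {} \<and> card C \<le> b.
            card C * (card (full_cycles C) * card (short_cycle_perms (A - C) b)))"
    by (intro sum.cong refl) (auto simp: card_perms_with_cycle)
  finally show ?thesis .
qed

lemma sum_subsets_by_card:
  fixes F :: "nat \<Rightarrow> 'b :: comm_semiring_1"
  assumes "finite A"
  shows "(\<Sum>C | C \<subseteq> A \<and> C \<noteq> {} \<and> card C \<le> b. F (card C))
       = (\<Sum>m = 1..min b (card A). of_nat (card A choose m) * F m)"
proof -
  let ?T = "{C. C \<subseteq> A \<and> C \<noteq> {} \<and> card C \<le> b}"
  have fin: "finite ?T" using assms by auto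
  have "card ` ?T \<subseteq> {1..min b (card A)}"
  proof (rule image_subsetI)
    fix C assume "C \<in> ?T"
    then have C: "C \<subseteq> A" "C \<noteq> {}" "card C \<le> b" by auto
    then have "card C \<noteq> 0" using finite_subset[OF C(1) assms] by simp
    then show "card C \<in> {1..min b (card A)}" using C card_mono[OF assms C(1)] by simp
  qed
  then have "(\<Sum>C\<in>?T. F (card C)) = (\<Sum>m = 1..min b (card A). \<Sum>C\<in>{C\<in>?T. card C = m}. F (card C))"
    using fin by (intro sum.group[symmetric]) auto
  also have "\<dots> = (\<Sum>m = 1..min b (card A). of_nat (card A choose m) * F m)"
  proof (rule sum.cong[OF refl])
    fix m assume m: "m \<in> {1..min b (card A)}"
    then have "{C\<in>?T. card C = m} = {C. C \<subseteq> A \<and> card C = m}" by auto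
    then show "(\<Sum>C\<in>{C\<in>?T. card C = m}. F (card C)) = of_nat (card A choose m) * F m"
      by (simp add: n_subsets[OF assms])
  qed
  finally show ?thesis .
qed

lemma choose_mult_fact_fact:
  assumes "m \<le> k"
  shows "real (k choose m) * fact m * fact (k - m) = fact k"
  by (simp add: binomial_fact[OF assms])

text \<open>
  Instead of enumerating cyclic arrangements, this compares two expressions for \<open>k * k!\<close>: the double
  count over all permutations of \<open>A\<close>, and the same sum with \<open>(card C - 1)!\<close> in place of the number of
  cycles on \<open>C\<close>, which equals \<open>k * k!\<close> because each size contributes \<open>k!\<close>. By induction the two agree
  in every term with \<open>C \<noteq> A\<close>, hence also in the term \<open>C = A\<close>.
\<close>
lemma card_full_cycles:
  assumes "finite A" "A \<noteq> {}"
  shows "card (full_cycles A) = fact (card A - 1)"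
  using assms
proof (induction A rule: finite_psubset_induct)
  case (psubset A)
  let ?k = "card A" and ?T = "{C. C \<subseteq> A \<and> C \<noteq> {} \<and> card C \<le> card A}"
  define g where "g C = real (card C * (card (full_cycles C) * card (short_cycle_perms (A - C) ?k)))" for C
  have short: "real (card (short_cycle_perms (A - C) ?k)) = fact (?k - card C)" if "C \<subseteq> A" for C
  proof -
    have "short_cycle_perms (A - C) ?k = {\<sigma>. \<sigma> permutes (A - C)}"
      using card_mono[OF psubset(1), of "orbit _ _"] permutes_orbit_subset[of _ "A - C"]
      by (fastforce simp: short_cycle_perms_def)
    moreover have "card (A - C) = ?k - card C"
      using that psubset(1) by (simp add: card_Diff_subset finite_subset)
    ultimately show ?thesis using card_permutations[of "A - C" "?k - card C"] psubset(1) by simp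
  qed
  have "sum g ?T = real (?k * card (short_cycle_perms A ?k))"
    unfolding card_mult_card_short_cycle_perms[OF psubset(1)] g_def by simp
  also have "\<dots> = (\<Sum>m = 1..?k. fact ?k)"
    using short[of "{}"] by simp
  also have "\<dots> = (\<Sum>m = 1..min ?k ?k. real (?k choose m) * (fact m * fact (?k - m)))"
    by (rule sum.cong) (auto simp: choose_mult_fact_fact simp flip: mult.assoc)
  also have "\<dots> = (\<Sum>C\<in>?T. fact (card C) * fact (?k - card C))"
    by (rule sum_subsets_by_card[OF psubset(1), symmetric])
  finally have eq: "sum g ?T = (\<Sum>C\<in>?T. fact (card C) * fact (?k - card C))" .
  have fin: "finite ?T" and A: "A \<in> ?T" using psubset by auto
  have "sum g (?T - {A}) = (\<Sum>C\<in>?T - {A}. fact (card C) * fact (?k - card C))"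
  proof (rule sum.cong[OF refl])
    fix C assume C: "C \<in> ?T - {A}"
    then have "card (full_cycles C) = fact (card C - 1)" using psubset.IH[of C] by auto
    moreover have "card C > 0" using C psubset(1) by (auto simp: card_gt_0_iff intro: finite_subset)
    ultimately show "g C = fact (card C) * fact (?k - card C)"
      using short[of C] C by (simp add: g_def fact_reduce[of "card C"])
  qed
  with eq have "g A = fact ?k * fact (?k - ?k)"
    by (simp add: sum.remove[OF fin A])
  moreover have "?k > 0" using psubset by (simp add: card_gt_0_iff)
  ultimately have "real (card (full_cycles A)) = fact (?k - 1)"
    using short[of A] by (simp add: g_def fact_reduce[of ?k])
  then have "real (card (full_cycles A)) = real (fact (?k - 1))" by (simp only: of_nat_fact)
  then show ?case by (simp only: of_nat_eq_iff)
qed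

text \<open>
  This is the coefficient of \<open>z ^ k\<close> in the exponential of \<open>z + z ^ 2 / 2 + \<dots> + z ^ b / b\<close>, a
  discrete analogue of the Dickman function; the recursion compares coefficients in the logarithmic
  derivative.
\<close>
function short_perm_density :: "nat \<Rightarrow> nat \<Rightarrow> real" where
  "short_perm_density b k =
     (if k = 0 then 1 else (\<Sum>j\<in>{1..min b k}. short_perm_density b (k - j)) / real k)"
  by pat_completeness auto
termination by (relation "Wellfounded.measure snd") simp_all

declare short_perm_density.simps [simp del]

lemma short_perm_density_0 [simp]: "short_perm_density b 0 = 1"
  by (subst short_perm_density.simps) simp

lemma short_perm_density_rec:
  assumes "k > 0"
  shows "real k * short_perm_density b k = (\<Sum>j = 1..min b k. short_perm_density b (k - j))"
  using assms by (subst short_perm_density.simps) simp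

lemma card_short_cycle_perms:
  assumes "finite A"
  shows "real (card (short_cycle_perms A b)) = fact (card A) * short_perm_density b (card A)"
  using assms
proof (induction A rule: finite_psubset_induct)
  case (psubset A)
  let ?k = "card A" and ?T = "{C. C \<subseteq> A \<and> C \<noteq> {} \<and> card C \<le> b}"
  show ?case
  proof (cases "A = {}")
    case True
    then have "short_cycle_perms A b = {id}" by (auto simp: short_cycle_perms_def)
    with True show ?thesis by simp
  next
    case False
    then have k: "?k > 0" using psubset by (simp add: card_gt_0_iff)
    have "real ?k * real (card (short_cycle_perms A b))
        = (\<Sum>C\<in>?T. fact (card C) * (fact (?k - card C) * short_perm_density b (?k - card C)))"
      unfolding of_nat_mult[symmetric] card_mult_card_short_cycle_perms[OF psubset(1)] of_nat_sum
    proof (rule sum.cong[OF refl])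
      fix C assume C: "C \<in> ?T"
      then have finC: "finite C" and "card C > 0"
        using psubset(1) by (auto simp: card_gt_0_iff intro: finite_subset)
      moreover have "card (A - C) = ?k - card C" using C finC by (simp add: card_Diff_subset)
      ultimately show "real (card C * (card (full_cycles C) * card (short_cycle_perms (A - C) b)))
          = fact (card C) * (fact (?k - card C) * short_perm_density b (?k - card C))"
        using C psubset.IH[of "A - C"] card_full_cycles[OF finC]
        by (auto simp: fact_reduce[of "card C"])
    qed
    also have "\<dots> = (\<Sum>m = 1..min b ?k.
        real (?k choose m) * (fact m * (fact (?k - m) * short_perm_density b (?k - m))))"
      by (rule sum_subsets_by_card[OF psubset(1)])
    also have "\<dots> = (\<Sum>m = 1..min b ?k. fact ?k * short_perm_density b (?k - m))"
      by (intro sum.cong refl) (simp add: choose_mult_fact_fact flip: mult.assoc)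
    also have "\<dots> = real ?k * (fact ?k * short_perm_density b ?k)"
      using short_perm_density_rec[OF k, of b] by (simp add: sum_distrib_left[symmetric])
    finally show ?thesis using k by simp
  qed
qed

text \<open>
  Summing over the candidate sets \<open>C\<close> instead of over permutations: there are \<open>card A choose m\<close> of
  them, and each is a cycle of the same number of permutations.
\<close>
lemma sum_cycles_of_length:
  assumes "finite A" "1 \<le> m" "m \<le> b" "m \<le> card A"
  shows "(\<Sum>\<sigma>\<in>short_cycle_perms A b. real (card {C. C \<subseteq> A \<and> cyclic_on \<sigma> C \<and> card C = m}))
       = fact (card A) * short_perm_density b (card A - m) / real m"
proof -
  let ?S = "short_cycle_perms A b" and ?k = "card A" and ?T = "{C. C \<subseteq> A \<and> card C = m}"
  have finT: "finite ?T" using assms by auto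
  have "(\<Sum>\<sigma>\<in>?S. real (card {C. C \<subseteq> A \<and> cyclic_on \<sigma> C \<and> card C = m}))
      = (\<Sum>\<sigma>\<in>?S. \<Sum>C\<in>?T. if cyclic_on \<sigma> C then 1 else 0)"
    using finT by (intro sum.cong refl) (auto simp: sum.inter_filter[symmetric] intro!: arg_cong[of _ _ card])
  also have "\<dots> = (\<Sum>C\<in>?T. \<Sum>\<sigma>\<in>?S. if cyclic_on \<sigma> C then 1 else 0)"
    by (rule sum.swap)
  also have "\<dots> = (\<Sum>C\<in>?T. fact (m - 1) * (fact (?k - m) * short_perm_density b (?k - m)))"
  proof (rule sum.cong[OF refl])
    fix C assume C: "C \<in> ?T"
    then have "finite C" "C \<noteq> {}" using assms finite_subset by auto
    then have "real (card {\<sigma> \<in> ?S. cyclic_on \<sigma> C})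
        = fact (m - 1) * (fact (?k - m) * short_perm_density b (?k - m))"
      using C assms by (simp add: card_perms_with_cycle card_full_cycles card_short_cycle_perms card_Diff_subset)
    then show "(\<Sum>\<sigma>\<in>?S. if cyclic_on \<sigma> C then 1 else 0)
        = fact (m - 1) * (fact (?k - m) * short_perm_density b (?k - m))"
      using finite_short_cycle_perms[OF assms(1), of b] by (simp add: sum.inter_filter[symmetric])
  qed
  also have "\<dots> = real (?k choose m) * fact m * fact (?k - m) * short_perm_density b (?k - m) / real m"
    using assms by (simp add: n_subsets fact_reduce[of m])
  finally show ?thesis using assms by (simp only: choose_mult_fact_fact)
qed

lemma bounded_cycle_perms_eq:
  assumes "b \<ge> 0"
  shows "bounded_cycle_perms n b = short_cycle_perms {1..n} (nat \<lfloor>b\<rfloor>)"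
proof -
  have "real c \<le> b \<longleftrightarrow> c \<le> nat \<lfloor>b\<rfloor>" for c
  proof
    show "c \<le> nat \<lfloor>b\<rfloor>" if "real c \<le> b" using that by (rule le_nat_floor)
    show "real c \<le> b" if "c \<le> nat \<lfloor>b\<rfloor>"
      using that of_nat_floor[OF assms] by (meson of_nat_mono order_trans)
  qed
  then show ?thesis
    unfolding bounded_cycle_perms_def short_cycle_perms_def perm_cycles_def ball_simps by blast
qed

text \<open>
  Only the integer part of the length bound matters for the counts, so the real parameter is
  exchanged for its floor here.
\<close>
lemma expectation_cycle_count:
  assumes "1 \<le> m" "real m \<le> b" "m \<le> n"
  defines "h \<equiv> short_perm_density (nat \<lfloor>b\<rfloor>)"
  shows "measure_pmf.expectation (bounded_cycle_pmf n b) (\<lambda>\<sigma>. real (cycle_count n m \<sigma>))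
       = h (n - m) / h n / real m"
proof -
  let ?S = "short_cycle_perms {1..n} (nat \<lfloor>b\<rfloor>)"
  have b: "b \<ge> 1" using assms by linarith
  have S: "bounded_cycle_perms n b = ?S" using b by (intro bounded_cycle_perms_eq) auto
  have "cycle_count n m \<sigma> = card {C. C \<subseteq> {1..n} \<and> cyclic_on \<sigma> C \<and> card C = m}" if "\<sigma> \<in> ?S" for \<sigma>
    using that cyclic_subsets_eq_orbits[of \<sigma> "{1..n}"]
    by (auto simp: cycle_count_def perm_cycles_def short_cycle_perms_def intro!: arg_cong[of _ _ card])
  then have "(\<Sum>\<sigma>\<in>?S. real (cycle_count n m \<sigma>)) = fact n * h (n - m) / real m"
    using sum_cycles_of_length[of "{1..n}" m "nat \<lfloor>b\<rfloor>"] assms by (simp add: le_nat_floor)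
  moreover have "real (card ?S) = fact n * h n"
    using card_short_cycle_perms[of "{1..n}"] by (simp add: h_def)
  moreover have "finite ?S" "?S \<noteq> {}"
    using id_in_bounded_cycle_perms[OF b, of n] S finite_bounded_cycle_perms[of n b] by auto
  ultimately show ?thesis
    by (simp add: bounded_cycle_pmf_def S integral_pmf_of_set field_simps)
qed

section \<open>Log-concavity of the densities\<close>

text \<open>
  The analytic part of the argument uses only that \<open>k * h k\<close> is the sum of \<open>h\<close> over the window of
  length \<open>b\<close> below \<open>k\<close>, which is truncated at \<open>0\<close> for \<open>k < b\<close>.
\<close>
locale window_recursion =
  fixes b :: nat and h :: "nat \<Rightarrow> real"
  assumes b_pos: "b \<ge> 1"
    and h_0: "h 0 = 1"
    and h_rec: "k > 0 \<Longrightarrow> real k * h k = (\<Sum>j = 1..min b k. h (k - j))"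
begin

lemma h_rec_full: "k \<ge> b \<Longrightarrow> real k * h k = (\<Sum>j = 1..b. h (k - j))"
  using h_rec[of k] b_pos by (simp add: min_absorb1)

lemma h_eq_1: "k \<le> b \<Longrightarrow> h k = 1"
proof (induction k rule: less_induct)
  case (less k)
  show ?case
  proof (cases "k = 0")
    case False
    then have "real k * h k = (\<Sum>j = 1..k. h (k - j))"
      using h_rec[of k] less.prems by (simp add: min_absorb2)
    also have "\<dots> = (\<Sum>j = 1..k. 1)"
      using less by (intro sum.cong) auto
    finally show ?thesis using False by simp
  qed (simp add: h_0)
qed

lemma h_pos: "h k > 0"
proof (induction k rule: less_induct)
  case (less k)
  show ?case
  proof (cases "k = 0")
    case False
    then have "(\<Sum>j = 1..min b k. h (k - j)) > 0"
      using less b_pos by (intro sum_pos) auto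
    then have "real k * h k > 0" using h_rec[of k] False by simp
    then show ?thesis by (simp add: zero_less_mult_iff)
  qed (simp add: h_0)
qed

text \<open>
  The windows of \<open>k\<close> and \<open>Suc k\<close> differ only by the entry \<open>h k\<close> and the outgoing entry \<open>h (k - b)\<close>.
  This is the discrete form of the delay equation \<open>u \<rho>'(u) = - \<rho>(u - 1)\<close> of the Dickman function.
\<close>
lemma h_step:
  assumes "k \<ge> b"
  shows "(real k + 1) * (h k - h (Suc k)) = h (k - b)"
proof -
  have "real (Suc k) * h (Suc k) = (\<Sum>j = Suc 0..Suc (b - 1). h (Suc k - j))"
    using h_rec_full[of "Suc k"] assms b_pos by simp
  also have "\<dots> = (\<Sum>j = 0..b - 1. h (k - j))"
    by (subst sum.shift_bounds_cl_Suc_ivl) simp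
  also have "\<dots> + h (k - b) = (\<Sum>j = 0..b. h (k - j))"
    using b_pos by (cases b) auto
  also have "\<dots> = h k + real k * h k"
    using h_rec_full[OF assms] by (simp add: sum.atLeast_Suc_atMost)
  finally show ?thesis by (simp add: algebra_simps)
qed

definition q :: "nat \<Rightarrow> real" where
  "q k = h (Suc k) / h k"

lemma q_pos: "q k > 0"
  using h_pos by (simp add: q_def)

lemma h_Suc: "h (Suc k) = h k * q k"
  using h_pos[of k] by (simp add: q_def)

lemma q_below: "k < b \<Longrightarrow> q k = 1"
  by (simp add: q_def h_eq_1)

lemma q_above:
  assumes "k \<ge> b"
  shows "(real k + 1) * (1 - q k) = h (k - b) / h k"
  using h_step[OF assms] h_pos[of k] by (simp add: h_Suc field_simps)

lemma q_le_1: "q k \<le> 1"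
proof (cases "k < b")
  case False
  then have "(real k + 1) * (1 - q k) > 0"
    using q_above[of k] h_pos by simp
  then show ?thesis by (simp add: zero_less_mult_iff)
qed (simp add: q_below)

text \<open>
  Log-concavity of \<open>h\<close>. By \<open>q_above\<close>, a decrease of \<open>q\<close> at \<open>k\<close> means that
  \<open>h (k - b) / ((k + 1) * h k)\<close> increases, which after cancelling is
  \<open>(k + 2) * q k \<le> (k + 1) * q (k - b)\<close>: over a window, \<open>q\<close> has to drop by a definite factor. That drop
  comes from the window sum itself: each term \<open>h (k + 1 - j)\<close> is \<open>q (k - j) * h (k - j)\<close>,
  and by induction \<open>q (k - j) \<le> q (k - b)\<close>, so \<open>(k + 1) * h (k + 1) \<le> q (k - b) * (k * h k)\<close>. This says
  \<open>(k + 1) * q k \<le> k * q (k - b)\<close>, which is slightly more than required.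
\<close>
lemma q_Suc_le: "q (Suc k) \<le> q k"
proof (induction k rule: less_induct)
  case (less k)
  show ?case
  proof (cases "k \<ge> b")
    case False
    then show ?thesis using q_below[of k] q_le_1 by simp
  next
    case True
    have mono: "q (k - j) \<le> q (k - b)" if "j \<in> {1..b}" for j
    proof -
      have "q (i + d) \<le> q i" if "i + d \<le> k" for i d
        using that
      proof (induction d)
        case (Suc d)
        then show ?case using less.IH[of "i + d"] by simp
      qed simp
      from this[of "k - b" "b - j"] show ?thesis using that True by simp
    qed
    have "(real k + 1) * (h k * q k) = (\<Sum>j = 1..b. h (Suc k - j))"
      using h_rec_full[of "Suc k"] True by (simp add: h_Suc algebra_simps)
    also have "\<dots> = (\<Sum>j = 1..b. h (k - j) * q (k - j))"
      using True by (intro sum.cong) (auto simp: Suc_diff_le h_Suc)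
    also have "\<dots> \<le> (\<Sum>j = 1..b. h (k - j) * q (k - b))"
      using mono h_pos by (intro sum_mono mult_left_mono) (auto intro: less_imp_le)
    also have "\<dots> = real k * h k * q (k - b)"
      using h_rec_full[OF True] by (simp add: sum_distrib_right)
    finally have "h k * ((real k + 1) * q k) \<le> h k * (real k * q (k - b))"
      by (simp add: mult_ac)
    then have A: "(real k + 1) * q k \<le> real k * q (k - b)"
      using h_pos[of k] by simp
    have "(real k + 2) * q k * (real k + 1) \<le> (real k + 2) * (real k * q (k - b))"
      using mult_left_mono[OF A, of "real k + 2"] by (simp add: mult_ac)
    \<comment> \<open>\<open>(k + 2) * k \<le> (k + 1) ^ 2\<close>\<close>
    also have "\<dots> \<le> (real k + 1) * q (k - b) * (real k + 1)"
      using q_pos[of "k - b"] by (simp add: algebra_simps)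
    finally have B: "(real k + 2) * q k \<le> (real k + 1) * q (k - b)"
      by (rule mult_right_le_imp_le) simp
    have C: "(real k + 1) * (1 - q k) = h (k - b) / h k"
      by (rule q_above[OF True])
    have D: "(real k + 2) * (1 - q (Suc k)) = h (k - b) / h k * (q (k - b) / q k)"
    proof -
      have "(real k + 2) * (1 - q (Suc k)) = h (Suc k - b) / h (Suc k)"
        using q_above[of "Suc k"] True by (simp add: add.commute)
      also have "h (Suc k - b) = h (k - b) * q (k - b)"
        using True by (simp add: Suc_diff_le h_Suc)
      finally show ?thesis by (simp add: h_Suc)
    qed
    have "(real k + 1) * ((real k + 2) * (1 - q k)) = h (k - b) / h k * (real k + 2)"
      unfolding C[symmetric] by (simp add: mult_ac)
    also have "\<dots> \<le> h (k - b) / h k * ((real k + 1) * (q (k - b) / q k))"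
      using B q_pos[of k] h_pos by (intro mult_left_mono) (auto simp: field_simps less_imp_le)
    also have "\<dots> = (real k + 1) * ((real k + 2) * (1 - q (Suc k)))"
      unfolding D by (simp add: mult_ac)
    finally show ?thesis by simp
  qed
qed

lemma q_antimono: "i \<le> k \<Longrightarrow> q k \<le> q i"
  by (rule lift_Suc_antimono_le[of q, OF q_Suc_le])

section \<open>Ratios of densities and the saddle point equation\<close>

lemma h_add_le: "h (i + m) \<le> h i * q i ^ m"
proof (induction m)
  case (Suc m)
  have "h (i + Suc m) = h (i + m) * q (i + m)" by (simp add: h_Suc)
  also have "\<dots> \<le> (h i * q i ^ m) * q i"
    using Suc h_pos q_pos q_antimono by (intro mult_mono) (auto intro: less_imp_le mult_nonneg_nonneg)
  finally show ?case by (simp add: mult_ac)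
qed simp

lemma h_add_ge: "i + m \<le> Suc t \<Longrightarrow> h i * q t ^ m \<le> h (i + m)"
proof (induction m)
  case (Suc m)
  have "(h i * q t ^ m) * q t \<le> h (i + m) * q (i + m)"
    using Suc h_pos q_pos q_antimono by (intro mult_mono) (auto intro: less_imp_le mult_nonneg_nonneg)
  then show ?case by (simp add: h_Suc mult_ac)
qed simp

text \<open>
  The inverse of \<open>q k\<close> is the ratio \<open>R (k + 1)\<close>. The recursion is used at \<open>k + b\<close>, where the whole window
  lies at or above \<open>k\<close>, so that all ratios that occur are at least \<open>R (k + 1)\<close>.
\<close>
lemma sum_powers_inverse_q_le: "(\<Sum>j = 1..b. (1 / q k) ^ j) \<le> real k + real b"
proof -
  let ?N = "k + b"
  have "h ?N * (\<Sum>j = 1..b. (1 / q k) ^ j) = (\<Sum>j = 1..b. h ?N * (1 / q k) ^ j)"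
    by (rule sum_distrib_left)
  also have "\<dots> \<le> (\<Sum>j = 1..b. h (?N - j))"
  proof (rule sum_mono)
    fix j assume j: "j \<in> {1..b}"
    then have "h ?N \<le> h (?N - j) * q (?N - j) ^ j"
      using h_add_le[of "?N - j" j] by simp
    also have "\<dots> \<le> h (?N - j) * q k ^ j"
      using j h_pos q_pos q_antimono by (intro mult_left_mono power_mono) (auto intro: less_imp_le)
    finally show "h ?N * (1 / q k) ^ j \<le> h (?N - j)"
      using q_pos[of k] by (simp add: power_one_over field_simps)
  qed
  also have "\<dots> = h ?N * (real k + real b)"
    using h_rec_full[of ?N] by (simp add: mult_ac)
  finally show ?thesis using h_pos[of ?N] by simp
qed

text \<open>
  The recursion is used at \<open>k + 1\<close>, where all ratios that occur are at most \<open>R (k + 1)\<close>. Extending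
  a window truncated at \<open>0\<close> to full length only helps.
\<close>
lemma sum_powers_inverse_q_ge: "real k + 1 \<le> (\<Sum>j = 1..b. (1 / q k) ^ j)"
proof -
  have "h (Suc k) * (real k + 1) = (\<Sum>j = 1..min b (Suc k). h (Suc k - j))"
    using h_rec[of "Suc k"] by (simp add: algebra_simps)
  also have "\<dots> \<le> (\<Sum>j = 1..min b (Suc k). h (Suc k) * (1 / q k) ^ j)"
  proof (rule sum_mono)
    fix j assume "j \<in> {1..min b (Suc k)}"
    then have "h (Suc k - j) * q k ^ j \<le> h (Suc k)"
      using h_add_ge[of "Suc k - j" j k] by simp
    then show "h (Suc k - j) \<le> h (Suc k) * (1 / q k) ^ j"
      using q_pos[of k] by (simp add: power_one_over field_simps)
  qed
  also have "\<dots> \<le> (\<Sum>j = 1..b. h (Suc k) * (1 / q k) ^ j)"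
    using h_pos[of "Suc k"] q_pos[of k] by (intro sum_mono2) (auto intro: less_imp_le)
  also have "\<dots> = h (Suc k) * (\<Sum>j = 1..b. (1 / q k) ^ j)"
    by (rule sum_distrib_left[symmetric])
  finally show ?thesis using h_pos[of "Suc k"] by simp
qed

end

text \<open>
  The weights \<open>x ^ j\<close> increase with \<open>j\<close>, so by Chebyshev's sum inequality the weighted mean of the
  indices is at least their plain mean \<open>(b + 1) / 2\<close>.
\<close>
lemma sum_index_powers_ge:
  fixes x :: real
  assumes "x \<ge> 1"
  shows "real b * (\<Sum>j = 1..b. x ^ j) \<le> 2 * (\<Sum>j = 1..b. real j * x ^ j)"
proof -
  have shift: "(\<Sum>j = 1..b. F j) = (\<Sum>j = 0..<b. F (Suc j))" for F :: "nat \<Rightarrow> real"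
    using sum.atLeast1_atMost_eq[of F b] by (simp add: atLeast0LessThan)
  have sumj: "2 * (\<Sum>j = 0..<b. real (Suc j)) = real b * (real b + 1)"
    by (induction b) (auto simp: algebra_simps)
  have "(\<Sum>j = 0..<b. real (Suc j)) * (\<Sum>j = 0..<b. x ^ Suc j)
      \<le> real b * (\<Sum>j = 0..<b. real (Suc j) * x ^ Suc j)"
    using assms Chebyshev_sum_upper[of b "\<lambda>j. real (Suc j)" "\<lambda>j. - (x ^ Suc j)"]
    by (simp add: sum_negf power_increasing del: power_Suc of_nat_Suc)
  then have "(2 * (\<Sum>j = 0..<b. real (Suc j))) * (\<Sum>j = 0..<b. x ^ Suc j)
      \<le> real b * (2 * (\<Sum>j = 0..<b. real (Suc j) * x ^ Suc j))"
    by linarith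
  then have "real b * ((real b + 1) * (\<Sum>j = 0..<b. x ^ Suc j))
      \<le> real b * (2 * (\<Sum>j = 0..<b. real (Suc j) * x ^ Suc j))"
    unfolding sumj mult.assoc .
  moreover have "real b * (\<Sum>j = 0..<b. x ^ Suc j) \<le> (real b + 1) * (\<Sum>j = 0..<b. x ^ Suc j)"
    using assms by (intro mult_right_mono sum_nonneg) auto
  ultimately show ?thesis
    unfolding shift by (cases "b = 0") (simp_all del: power_Suc of_nat_Suc)
qed

text \<open>
  Stability of the saddle point equation: \<open>f\<close> is convex as a function of \<open>ln x\<close>, and by the previous
  lemma its derivative there is at least \<open>b / 2 * f x\<close>. Hence \<open>b * ln (y / x)\<close> is at most twice the
  relative increment of \<open>f\<close>.
\<close>
lemma power_ratio_le_exp: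
  fixes x y :: real
  assumes "1 \<le> x" "x \<le> y" "m \<le> b" "b \<ge> 1"
  defines "f \<equiv> \<lambda>x. \<Sum>j = 1..b. x ^ j"
  shows "y ^ m \<le> x ^ m * exp (2 * (f y - f x) / f x)"
proof -
  define t where "t = ln (y / x)"
  have t: "t \<ge> 0" and y: "y = x * exp t" using assms(1,2) by (auto simp: t_def)
  have fx: "f x > 0" unfolding f_def using assms(1,4) by (intro sum_pos) auto
  have "f x + t * (\<Sum>j = 1..b. real j * x ^ j) = (\<Sum>j = 1..b. x ^ j * (1 + real j * t))"
    by (simp add: f_def sum.distrib sum_distrib_left algebra_simps)
  also have "\<dots> \<le> (\<Sum>j = 1..b. x ^ j * exp (real j * t))"
    using assms(1) by (intro sum_mono mult_left_mono) auto
  also have "\<dots> = f y"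
    by (simp add: f_def y power_mult_distrib exp_of_nat_mult)
  finally have "2 * t * (\<Sum>j = 1..b. real j * x ^ j) \<le> 2 * (f y - f x)" by simp
  moreover have "t * (real b * f x) \<le> t * (2 * (\<Sum>j = 1..b. real j * x ^ j))"
    using sum_index_powers_ge[OF assms(1), of b] t by (intro mult_left_mono) (auto simp: f_def)
  ultimately have "real b * t \<le> 2 * (f y - f x) / f x"
    using fx by (simp add: field_simps)
  moreover have "real m * t \<le> real b * t" using assms(3) t by (intro mult_right_mono) auto
  ultimately have "exp (real m * t) \<le> exp (2 * (f y - f x) / f x)" by simp
  then show ?thesis
    using assms(1) by (simp add: y power_mult_distrib exp_of_nat_mult)
qed

lemma sum_powers_strict_mono:
  fixes x y :: real
  assumes "0 \<le> x" "x < y" "b \<ge> 1"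
  shows "(\<Sum>j = 1..b. x ^ j) < (\<Sum>j = 1..b. y ^ j)"
  using assms by (intro sum_strict_mono) (auto intro: power_strict_mono)

text \<open>
  The quotient is a product of \<open>m\<close> consecutive ratios and thus lies between the \<open>m\<close>-th powers of
  the smallest one, with index \<open>n - m + 1\<close>, and the largest one, with index \<open>n\<close>. At the largest
  ratio \<open>f\<close> is less than \<open>n + b\<close>, at the smallest it is more than \<open>n - b\<close>, and \<open>f x = n\<close> at the
  saddle point. The condition \<open>2 * b \<le> n\<close> makes \<open>n - b\<close> comparable to \<open>n\<close>.
\<close>
lemma (in window_recursion) density_ratio_bounds:
  assumes x: "x > 0" "(\<Sum>j = 1..b. x ^ j) = real n" and n: "2 * b \<le> n" and m: "1 \<le> m" "m \<le> b"
  shows "h (n - m) / h n \<le> x ^ m * exp (4 * real b / real n)"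
    and "x ^ m * exp (- (4 * real b / real n)) \<le> h (n - m) / h n"
proof -
  let ?f = "\<lambda>x::real. \<Sum>j = 1..b. x ^ j"
  have npos: "real n > 0" and bn: "2 * real b \<le> real n" and mb: "real m \<le> real b"
    using n m by auto
  have x1: "x \<ge> 1"
  proof (rule ccontr)
    assume "\<not> x \<ge> 1"
    then have "?f x < ?f 1" using x b_pos by (intro sum_powers_strict_mono) auto
    then show False using x n b_pos by simp
  qed
  have upper: "h (n - m) / h n \<le> (1 / q (n - 1)) ^ m"
    using h_add_ge[of "n - m" m "n - 1"] n m h_pos[of n] q_pos[of "n - 1"]
    by (simp add: power_one_over field_simps)
  have lower: "(1 / q (n - m)) ^ m \<le> h (n - m) / h n"
    using h_add_le[of "n - m" m] n m h_pos[of n] q_pos[of "n - m"]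
    by (simp add: power_one_over field_simps)
  show "h (n - m) / h n \<le> x ^ m * exp (4 * real b / real n)"
  proof (cases "x \<le> 1 / q (n - 1)")
    case True
    have "2 * (?f (1 / q (n - 1)) - ?f x) / ?f x \<le> 4 * real b / real n"
    proof -
      have "2 * (?f (1 / q (n - 1)) - ?f x) \<le> 4 * real b"
        using sum_powers_inverse_q_le[of "n - 1"] x npos by (simp add: of_nat_diff)
      then show ?thesis unfolding x(2) by (intro divide_right_mono) auto
    qed
    then have "(1 / q (n - 1)) ^ m \<le> x ^ m * exp (4 * real b / real n)"
      using x1 by (intro order_trans[OF power_ratio_le_exp[OF x1 True m(2) b_pos]] mult_left_mono) auto
    with upper show ?thesis by linarith
  next
    case False
    then have "(1 / q (n - 1)) ^ m \<le> x ^ m * 1"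
      using q_pos[of "n - 1"] by (simp add: power_mono)
    also have "\<dots> \<le> x ^ m * exp (4 * real b / real n)"
      using x by (intro mult_left_mono) auto
    finally show ?thesis using upper by linarith
  qed
  show "x ^ m * exp (- (4 * real b / real n)) \<le> h (n - m) / h n"
  proof (cases "1 / q (n - m) \<le> x")
    case True
    let ?z = "1 / q (n - m)"
    have z1: "?z \<ge> 1" using q_pos[of "n - m"] q_le_1[of "n - m"] by simp
    have fz: "?f ?z \<ge> real n / 2" "?f x - ?f ?z \<le> real b"
      using sum_powers_inverse_q_ge[of "n - m"] bn mb m n x by (auto simp: of_nat_diff)
    have "2 * (?f x - ?f ?z) / ?f ?z \<le> 2 * real b / (real n / 2)"
      using fz npos by (intro frac_le) auto
    also have "\<dots> = 4 * real b / real n" by simp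
    finally have "exp (2 * (?f x - ?f ?z) / ?f ?z) \<le> exp (4 * real b / real n)"
      by (simp only: exp_le_cancel_iff)
    moreover have "0 \<le> ?z ^ m" using z1 by (intro zero_le_power) linarith
    ultimately have "x ^ m \<le> ?z ^ m * exp (4 * real b / real n)"
      using power_ratio_le_exp[OF z1 True m(2) b_pos] by (meson mult_left_mono order_trans)
    then have "x ^ m * exp (- (4 * real b / real n)) \<le> ?z ^ m"
      by (simp add: exp_minus field_simps)
    with lower show ?thesis by linarith
  next
    case False
    have "x ^ m * exp (- (4 * real b / real n)) \<le> x ^ m * 1"
      using x by (intro mult_left_mono) auto
    also have "\<dots> \<le> (1 / q (n - m)) ^ m"
      using False x by (simp add: power_mono del: power_one_over)
    finally show ?thesis using lower by linarith
  qed
qed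

section \<open>Logarithmic expansion of the saddle point\<close>

text \<open>
  With \<open>y = ln x\<close>, the geometric series gives \<open>exp (b * y) - 1 = n * (1 - exp (- y))\<close>. For small \<open>y\<close>
  the right-hand side is close to \<open>n * y = U * W\<close>, so \<open>exp W\<close> is close to \<open>U * W\<close>. The exact
  inequalities \<open>y * exp (- y) \<le> 1 - exp (- y) \<le> y\<close> keep the resulting error in \<open>W\<close> below \<open>y\<close>, the
  subtracted \<open>1\<close> contributes at most \<open>1 / U\<close>, and the real number \<open>a\<close> between \<open>b\<close> and \<open>b + 1\<close>
  changes the exponent \<open>b * y\<close> by at most \<open>y\<close>.
  The size of \<open>y\<close> itself is controlled by \<open>x ^ b \<le> n\<close>.
\<close>
lemma saddle_log_bounds:
  fixes x a :: real
  assumes x: "x > 1" "real n = (\<Sum>j = 1..b. x ^ j)" and a: "real b \<le> a" "a \<le> real b + 1" and b: "b \<ge> 1"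
    and U: "real n / a \<ge> 6"
  defines "W \<equiv> a * ln x" and "U \<equiv> real n / a"
  shows "1 \<le> W" "W \<le> 2 * ln (real n)"
    "\<bar>W - ln U - ln W\<bar> \<le> 1 / U + 2 * ln (real n) / a"
proof -
  define y where "y = ln x"
  have y: "y > 0" and xy: "x = exp y" using x by (auto simp: y_def)
  have apos: "a > 0" using a b by linarith
  have W: "W = a * y" by (simp add: W_def y_def)
  have Wpos: "W > 0" using W apos y by simp
  have UW: "U * W = real n * y" using apos by (simp add: U_def W)
  have Upos: "U \<ge> 6" using assms by simp
  have npos: "real n > 0" using U apos by (cases "n = 0") auto
  have xb: "x ^ b = exp (real b * y)" by (simp add: xy exp_of_nat_mult)
  have "x ^ b \<le> real n"
    unfolding x(2) using x(1) b by (intro member_le_sum) auto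
  then have b_y: "real b * y \<le> ln (real n)"
    using npos by (simp add: xb ln_ge_iff)
  have "a \<le> 2 * real b" using a b by linarith
  then have "W \<le> 2 * (real b * y)" using y by (simp add: W)
  with b_y show W_upper: "W \<le> 2 * ln (real n)" by linarith
  have y_small: "y \<le> 2 * ln (real n) / a"
    using W_upper apos by (simp add: W field_simps)
  have closed: "real n * (1 - exp (- y)) = exp (real b * y) - 1"
  proof -
    have "real n * (x - 1) = x * (x ^ b - 1)"
      unfolding x(2) by (induction b) (auto simp: algebra_simps)
    then have "real n * (x - 1) * exp (- y) = x * (x ^ b - 1) * exp (- y)" by simp
    then show ?thesis by (simp add: xb) (simp add: xy exp_minus field_simps)
  qed
  have "exp y \<ge> 1 + y" "exp (- y) \<ge> 1 + - y" by (rule exp_ge_add_one_self)+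
  then have lin: "1 - exp (- y) \<le> y" "y * exp (- y) \<le> 1 - exp (- y)"
    by (auto simp: exp_minus field_simps)
  have E1: "exp (real b * y) \<le> 1 + U * W"
    using closed mult_left_mono[OF lin(1), of "real n"] by (simp add: UW)
  have E2: "U * W * exp (- y) \<le> exp (real b * y) - 1"
    using closed mult_left_mono[OF lin(2), of "real n"] by (simp add: UW mult.assoc)
  have W_between: "real b * y \<le> W" "W \<le> real b * y + y"
    using a y mult_right_mono[of a "real b + 1" y] by (auto simp: W algebra_simps)
  \<comment> \<open>The equation \<open>exp W = U * W\<close> also has a small solution near \<open>1 / U\<close>. It is excluded here: the
     approximate equation with \<open>U \<ge> 6\<close> and \<open>W < 1\<close> would force \<open>2 * W \<le> exp W - 1 < 2 * W\<close>.\<close>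
  show W1: "1 \<le> W"
  proof (rule ccontr)
    assume "\<not> 1 \<le> W"
    then have "W \<le> 1" by simp
    have "a \<ge> 1" using a b by linarith
    then have "y \<le> W" using y by (simp add: W)
    then have "exp (- 1) \<le> exp (- y)" using \<open>W \<le> 1\<close> by simp
    moreover have "exp (-1 :: real) \<ge> 1 / 3" using exp_le by (simp add: exp_minus field_simps)
    ultimately have "exp (- y) \<ge> 1 / 3" by linarith
    have "6 * W * (1 / 3) \<le> U * W * exp (- y)"
      using Upos Wpos \<open>exp (- y) \<ge> 1 / 3\<close> by (intro mult_mono) auto
    also have "\<dots> \<le> exp W - 1"
      using E2 W_between by (smt (verit) exp_le_cancel_iff)
    also have "\<dots> \<le> W + W\<^sup>2"
      using exp_bound[of W] Wpos \<open>W \<le> 1\<close> by simp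
    finally have "2 * W \<le> W + W\<^sup>2" by simp
    moreover have "W\<^sup>2 < W * 1"
      unfolding power2_eq_square using Wpos \<open>\<not> 1 \<le> W\<close> by (intro mult_strict_left_mono) auto
    ultimately show False by simp
  qed
  have UWpos: "U * W > 0" using Upos Wpos by simp
  have upper: "W - ln U - ln W \<le> 1 / U + y"
  proof -
    have "real b * y \<le> ln (1 + U * W)"
      using E1 UWpos by (simp add: ln_ge_iff)
    also have "1 + U * W = U * W * (1 + 1 / (U * W))"
      using Upos Wpos by (simp add: field_simps)
    also have "ln \<dots> = ln (U * W) + ln (1 + 1 / (U * W))"
      using UWpos by (intro ln_mult_pos add_pos_pos) auto
    also have "ln (U * W) = ln U + ln W"
      using Upos Wpos by (intro ln_mult_pos) auto
    also have "ln (1 + 1 / (U * W)) \<le> 1 / (U * W)"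
      using UWpos by (intro ln_add_one_self_le_self) simp
    also have "1 / (U * W) \<le> 1 / U"
      using Upos W1 by (simp add: field_simps)
    finally show ?thesis using W_between by simp
  qed
  have lower: "- y \<le> W - ln U - ln W"
  proof -
    have "U * W * exp (- y) \<le> exp W"
      using E2 W_between by (smt (verit) exp_le_cancel_iff)
    then have "ln (U * W * exp (- y)) \<le> ln (exp W)"
      using Upos Wpos by (intro ln_mono mult_pos_pos) auto
    then have "ln (U * W * exp (- y)) \<le> W" by simp
    also have "ln (U * W * exp (- y)) = ln U + ln W - y"
      using Upos Wpos by (simp add: ln_mult)
    finally show ?thesis by simp
  qed
  show "\<bar>W - ln U - ln W\<bar> \<le> 1 / U + 2 * ln (real n) / a"
    using upper lower y_small Upos by (simp add: abs_le_iff)  (smt (verit) divide_nonneg_nonneg)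
qed

text \<open>
  If \<open>W\<close> is \<open>ln U + ln W\<close> up to \<open>d\<close>, then \<open>W / ln U = 1 + O (ln W / ln U)\<close>, and taking logarithms
  replaces \<open>ln W\<close> by \<open>ln (ln U)\<close> at that cost. The parameter \<open>l\<close> stands for \<open>ln n\<close>, to which \<open>W\<close> and
  \<open>ln U\<close> are both comparable.
\<close>
lemma log_fixed_point_expansion:
  fixes W U d :: real
  assumes W: "1 \<le> W" "W \<le> 2 * l" and U: "c * l \<le> ln U" "2 \<le> c * l" and c: "c > 0" "l > 0"
    and d: "\<bar>W - ln U - ln W\<bar> \<le> d" "d \<le> 1"
  shows "\<bar>W - ln U - ln (ln U)\<bar> \<le> d + (ln (2 * l) + 2 * d) / (c * l)"
proof -
  have L: "ln U > 0" using assms by linarith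
  have lW: "0 \<le> ln W" "ln W \<le> ln (2 * l)" using W by auto
  have d0: "d \<ge> 0" using d by linarith
  define s where "s = W / ln U"
  have spos: "s > 0" using W L by (simp add: s_def)
  have cl: "c * l > 0" using c by simp
  have "ln s \<le> (ln (2 * l) + 2 * d) / (c * l)"
  proof -
    have "ln s \<le> s - 1" using spos by (rule ln_le_minus_one)
    also have "\<dots> = (W - ln U) / ln U" using L by (simp add: s_def field_simps)
    also have "\<dots> \<le> (ln (2 * l) + 2 * d) / ln U"
      using d lW d0 L by (intro divide_right_mono) auto
    also have "\<dots> \<le> (ln (2 * l) + 2 * d) / (c * l)"
      using U cl lW d0 by (intro divide_left_mono) (auto simp: intro!: mult_pos_pos L)
    finally show ?thesis .
  qed
  moreover have "- ln s \<le> (ln (2 * l) + 2 * d) / (c * l)"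
  proof -
    have "W \<ge> ln U - d" using d lW by linarith
    then have Wh: "W \<ge> ln U / 2" using U d by linarith
    have "- ln s = ln (ln U / W)" using L W by (simp add: s_def ln_div)
    also have "\<dots> \<le> ln U / W - 1" using L W by (intro ln_le_minus_one) auto
    also have "\<dots> = (ln U - W) / W" using W by (simp add: field_simps)
    also have "\<dots> \<le> d / W" using \<open>W \<ge> ln U - d\<close> W by (intro divide_right_mono) auto
    also have "\<dots> \<le> d / (c * l / 2)"
      using Wh U cl d0 by (intro divide_left_mono) (auto intro!: mult_pos_pos)
    also have "\<dots> = (2 * d) / (c * l)" by simp
    also have "\<dots> \<le> (ln (2 * l) + 2 * d) / (c * l)"
      using cl lW by (intro divide_right_mono) auto
    finally show ?thesis .
  qed
  moreover have "ln W = ln s + ln (ln U)" using L W by (simp add: s_def ln_div)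
  ultimately show ?thesis using d by linarith
qed

lemma saddle_point_properties:
  assumes "n \<ge> 1" "a \<ge> 1"
  shows "saddle_point n a > 0"
    and "(\<Sum>j = 1..nat \<lfloor>a\<rfloor>. saddle_point n a ^ j) = real n"
proof -
  have "{j. 1 \<le> j \<and> real j \<le> a} = {1..nat \<lfloor>a\<rfloor>}"
    using assms(2) by (auto simp: le_nat_iff le_floor_iff)
  then show "saddle_point n a > 0" "(\<Sum>j = 1..nat \<lfloor>a\<rfloor>. saddle_point n a ^ j) = real n"
    using theI'[OF saddle_point_unique[OF assms]] by (simp_all add: saddle_point_def)
qed

text \<open>
  Here \<open>1 / U \<le> n powr (a2 - 1)\<close> and \<open>ln n / \<alpha> n \<le> ln n / n powr a1\<close>, so the error \<open>D\<close> in the fixed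
  point relation is polynomially small.
\<close>
lemma saddle_expansion:
  fixes a1 a2 :: real and \<alpha> :: "nat \<Rightarrow> real"
  assumes a: "0 < a1" "a2 < 1"
    and \<alpha>: "\<And>n. n \<ge> 1 \<Longrightarrow> real n powr a1 \<le> \<alpha> n \<and> \<alpha> n \<le> real n powr a2"
  shows "(\<lambda>n. \<alpha> n * ln (saddle_point n (\<alpha> n)) - ln (real n / \<alpha> n) - ln (ln (real n / \<alpha> n)))
      \<in> O[at_top](\<lambda>n. ln (ln (real n)) / ln (real n))"
proof -
  define c where "c = 1 - a2"
  define D where "D n = real n powr a2 / real n + 2 * ln (real n) / real n powr a1" for n :: nat
  have c: "c > 0" using a by (simp add: c_def)
  have "\<forall>\<^sub>F n in at_top. 6 \<le> real n / real n powr a2"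
    using a by real_asymp
  moreover have "\<forall>\<^sub>F n in at_top. D n \<le> 1"
  proof -
    have "(\<lambda>n::nat. real n powr a2 / real n) \<longlonglongrightarrow> 0" using a by real_asymp
    moreover have "(\<lambda>n::nat. 2 * ln (real n) / real n powr a1) \<longlonglongrightarrow> 0" using a by real_asymp
    ultimately have "D \<longlonglongrightarrow> 0 + 0" unfolding D_def by (rule tendsto_add)
    then have "\<forall>\<^sub>F n in at_top. D n < 1" by (intro order_tendstoD(2)[of D 0]) auto
    then show ?thesis by (rule eventually_mono) simp
  qed
  moreover have "\<forall>\<^sub>F n::nat in at_top. 2 \<le> c * ln (real n)"
    using c by real_asymp
  ultimately have "\<forall>\<^sub>F n in at_top.
      norm (\<alpha> n * ln (saddle_point n (\<alpha> n)) - ln (real n / \<alpha> n) - ln (ln (real n / \<alpha> n)))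
      \<le> 2 * D n + ln (2 * ln (real n)) / (c * ln (real n))"
    using eventually_gt_at_top[of 1]
  proof eventually_elim
    case (elim n)
    let ?x = "saddle_point n (\<alpha> n)" and ?U = "real n / \<alpha> n" and ?b = "nat \<lfloor>\<alpha> n\<rfloor>"
    have \<alpha>n: "real n powr a1 \<le> \<alpha> n" "\<alpha> n \<le> real n powr a2" using \<alpha>[of n] elim by auto
    have "1 \<le> real n powr a1" using elim a by (simp add: ge_one_powr_ge_zero)
    with \<alpha>n have \<alpha>1: "1 \<le> \<alpha> n" by linarith
    have b: "real ?b \<le> \<alpha> n" "\<alpha> n \<le> real ?b + 1" "?b \<ge> 1" using \<alpha>1 by linarith+
    note x = saddle_point_properties[OF _ \<alpha>1, of n]
    have U: "6 \<le> ?U"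
    proof -
      have "real n / real n powr a2 \<le> ?U"
        using \<alpha>n \<alpha>1 elim by (intro divide_left_mono) (auto intro!: mult_pos_pos)
      with elim show ?thesis by linarith
    qed
    have bn: "real ?b < real n"
    proof -
      have "6 * \<alpha> n \<le> real n" using U \<alpha>1 by (simp add: field_simps)
      with b \<alpha>1 show ?thesis by linarith
    qed
    have x1: "?x > 1"
    proof (rule ccontr)
      assume "\<not> ?x > 1"
      then have "(\<Sum>j = 1..?b. ?x ^ j) \<le> (\<Sum>j = 1..?b. 1 ^ j)"
        using x elim by (intro sum_mono power_mono) auto
      then show False using x bn elim by simp
    qed
    have n1: "n \<ge> 1" using elim by simp
    note bounds = saddle_log_bounds[OF x1 x(2)[OF n1, symmetric] b U]
    have lnn: "ln (real n) > 0" using elim by simp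
    have dD: "1 / ?U + 2 * ln (real n) / \<alpha> n \<le> D n"
    proof -
      have "1 / ?U \<le> real n powr a2 / real n"
        using \<alpha>n elim by (simp add: divide_right_mono)
      moreover have "2 * ln (real n) / \<alpha> n \<le> 2 * ln (real n) / real n powr a1"
        using \<alpha>n \<alpha>1 lnn elim by (intro divide_left_mono) (auto intro!: mult_pos_pos)
      ultimately show ?thesis by (simp add: D_def)
    qed
    have "c * ln (real n) = ln (real n) - ln (real n powr a2)"
      using elim by (simp add: c_def ln_powr algebra_simps)
    also have "\<dots> \<le> ln (real n) - ln (\<alpha> n)"
      using \<alpha>n \<alpha>1 by (intro diff_left_mono ln_mono) auto
    also have "\<dots> = ln ?U" using \<alpha>1 elim by (simp add: ln_div)
    finally have lnU: "c * ln (real n) \<le> ln ?U" .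
    have "D n \<ge> 0" using lnn by (simp add: D_def)
    then have "2 * D n / (c * ln (real n)) \<le> 2 * D n / 2"
      using elim by (intro divide_left_mono) auto
    then show ?case
      using log_fixed_point_expansion[OF bounds(1,2) lnU _ c lnn order_trans[OF bounds(3) dD]] elim
      by (simp add: add_divide_distrib)
  qed
  then have "(\<lambda>n. \<alpha> n * ln (saddle_point n (\<alpha> n)) - ln (real n / \<alpha> n) - ln (ln (real n / \<alpha> n)))
      \<in> O[at_top](\<lambda>n. 2 * D n + ln (2 * ln (real n)) / (c * ln (real n)))"
    by (intro bigoI[of _ 1]) (auto elim!: eventually_mono)
  also have "(\<lambda>n. 2 * D n + ln (2 * ln (real n)) / (c * ln (real n)))
      \<in> O[at_top](\<lambda>n. ln (ln (real n)) / ln (real n))"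
  proof (rule sum_in_bigo)
    have "(\<lambda>n::nat. real n powr a2 / real n) \<in> O(\<lambda>n. ln (ln (real n)) / ln (real n))"
      using a by real_asymp
    moreover have "(\<lambda>n::nat. 2 * ln (real n) / real n powr a1) \<in> O(\<lambda>n. ln (ln (real n)) / ln (real n))"
      using a by real_asymp
    ultimately have "D \<in> O(\<lambda>n. ln (ln (real n)) / ln (real n))"
      unfolding D_def by (rule sum_in_bigo)
    then show "(\<lambda>n. 2 * D n) \<in> O(\<lambda>n. ln (ln (real n)) / ln (real n))" by simp
    show "(\<lambda>n::nat. ln (2 * ln (real n)) / (c * ln (real n))) \<in> O(\<lambda>n. ln (ln (real n)) / ln (real n))"
      using c by real_asymp
  qed
  finally show ?thesis .
qed

section \<open>Expected cycle counts\<close>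

lemma window_recursion_short_perm_density:
  "b \<ge> 1 \<Longrightarrow> window_recursion b (short_perm_density b)"
  by unfold_locales (auto simp: short_perm_density_rec)

lemma expectation_cycle_count_bounds:
  assumes "1 \<le> m" "real m \<le> a" "2 * a \<le> real n"
  defines "E \<equiv> measure_pmf.expectation (bounded_cycle_pmf n a) (\<lambda>\<sigma>. real (cycle_count n m \<sigma>))"
  shows "E / cycle_mean n a m \<in> {exp (- (4 * a / real n))..exp (4 * a / real n)}"
proof -
  let ?b = "nat \<lfloor>a\<rfloor>" and ?x = "saddle_point n a"
  have a1: "a \<ge> 1" and mn: "m \<le> n" and n1: "n \<ge> 1" using assms by linarith+
  have b: "real ?b \<le> a" "?b \<ge> 1" using a1 by linarith+
  have mb: "m \<le> ?b" using assms(2) by (rule le_nat_floor)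
  have bn: "2 * ?b \<le> n" using b assms(3) by linarith
  note x = saddle_point_properties[OF n1 a1]
  interpret window_recursion ?b "short_perm_density ?b"
    using b(2) by (rule window_recursion_short_perm_density)
  have E: "E * real m = short_perm_density ?b (n - m) / short_perm_density ?b n"
    unfolding E_def using expectation_cycle_count[OF assms(1,2) mn] assms(1) by simp
  note bounds = density_ratio_bounds[OF x bn assms(1) mb, folded E]
  have xm: "?x ^ m > 0" using x by simp
  have ratio: "E / cycle_mean n a m = E * real m / ?x ^ m" by (simp add: cycle_mean_def)
  have eps: "4 * real ?b / real n \<le> 4 * a / real n" using b by (intro divide_right_mono) auto
  have "E * real m / ?x ^ m \<le> exp (4 * real ?b / real n)"
    using bounds(1) xm by (simp add: field_simps)
  moreover have "exp (- (4 * real ?b / real n)) \<le> E * real m / ?x ^ m"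
    using bounds(2) xm by (simp add: field_simps)
  moreover have "exp (4 * real ?b / real n) \<le> exp (4 * a / real n)"
      "exp (- (4 * a / real n)) \<le> exp (- (4 * real ?b / real n))"
    using eps by simp_all
  ultimately show "E / cycle_mean n a m \<in> {exp (- (4 * a / real n))..exp (4 * a / real n)}"
    unfolding ratio atLeastAtMost_iff by (meson order_trans)
qed

theorem proposition2p1:
  fixes a1 a2 :: real and \<alpha> :: "nat \<Rightarrow> real" and m :: "nat \<Rightarrow> nat"
  assumes "0 < a1" "a1 < 1" "0 < a2" "a2 < 1"
    and "\<And>n. n \<ge> 1 \<Longrightarrow> real n powr a1 \<le> \<alpha> n \<and> \<alpha> n \<le> real n powr a2"
    and "\<And>n. n \<ge> 1 \<Longrightarrow> m n \<ge> 1 \<and> real (m n) \<le> \<alpha> n"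
  shows "(\<lambda>n. measure_pmf.expectation (bounded_cycle_pmf n (\<alpha> n))
                 (\<lambda>\<sigma>. real (cycle_count n (m n) \<sigma>)))
           \<sim>[at_top] (\<lambda>n. cycle_mean n (\<alpha> n) (m n))
       \<and> (\<exists>r \<in> O[at_top](\<lambda>n. ln (ln (real n)) / ln (real n)).
           \<forall>\<^sub>F n in at_top.
             1 / real (m n) * ln (real (m n) * cycle_mean n (\<alpha> n) (m n))
               = ln (saddle_point n (\<alpha> n))
           \<and> ln (saddle_point n (\<alpha> n))
               = 1 / \<alpha> n * (ln (real n / \<alpha> n) + ln (ln (real n / \<alpha> n)) + r n))"
proof (intro conjI bexI)
  have \<alpha>_ge_1: "1 \<le> \<alpha> n" if "n \<ge> 1" for n
  proof -
    have "1 \<le> real n powr a1" using that assms(1) by (simp add: ge_one_powr_ge_zero)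
    with assms(5)[OF that] show ?thesis by linarith
  qed
  let ?E = "\<lambda>n. measure_pmf.expectation (bounded_cycle_pmf n (\<alpha> n)) (\<lambda>\<sigma>. real (cycle_count n (m n) \<sigma>))"
  let ?\<mu> = "\<lambda>n. cycle_mean n (\<alpha> n) (m n)"
  have "\<forall>\<^sub>F n::nat in at_top. 2 * real n powr a2 \<le> real n"
    using assms(4) by real_asymp
  then have bounds: "\<forall>\<^sub>F n in at_top.
      ?E n / ?\<mu> n \<in> {exp (- (4 * real n powr a2 / real n))..exp (4 * real n powr a2 / real n)}"
    using eventually_ge_at_top[of 1]
  proof eventually_elim
    case (elim n)
    have \<alpha>n: "2 * \<alpha> n \<le> real n" using assms(5)[of n] elim by linarith
    have "4 * \<alpha> n / real n \<le> 4 * real n powr a2 / real n"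
      using assms(5)[of n] elim by (intro divide_right_mono) auto
    then have "exp (4 * \<alpha> n / real n) \<le> exp (4 * real n powr a2 / real n)"
        "exp (- (4 * real n powr a2 / real n)) \<le> exp (- (4 * \<alpha> n / real n))"
      by simp_all
    then show ?case
      using expectation_cycle_count_bounds[of "m n" "\<alpha> n" n] assms(6)[of n] elim \<alpha>n
      unfolding atLeastAtMost_iff by (meson order_trans)
  qed
  have "(\<lambda>n. ?E n / ?\<mu> n) \<longlonglongrightarrow> 1"
  proof (rule tendsto_sandwich)
    show "\<forall>\<^sub>F n in at_top. exp (- (4 * real n powr a2 / real n)) \<le> ?E n / ?\<mu> n"
      using bounds by (rule eventually_mono) simp
    show "\<forall>\<^sub>F n in at_top. ?E n / ?\<mu> n \<le> exp (4 * real n powr a2 / real n)"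
      using bounds by (rule eventually_mono) simp
    show "(\<lambda>n::nat. exp (- (4 * real n powr a2 / real n))) \<longlonglongrightarrow> 1"
      using assms(4) by real_asymp
    show "(\<lambda>n::nat. exp (4 * real n powr a2 / real n)) \<longlonglongrightarrow> 1"
      using assms(4) by real_asymp
  qed
  then show "?E \<sim>[at_top] ?\<mu>" by (rule asymp_equivI')
  let ?r = "\<lambda>n. \<alpha> n * ln (saddle_point n (\<alpha> n)) - ln (real n / \<alpha> n) - ln (ln (real n / \<alpha> n))"
  show "?r \<in> O[at_top](\<lambda>n. ln (ln (real n)) / ln (real n))"
    using assms by (intro saddle_expansion[of a1 a2]) auto
  show "\<forall>\<^sub>F n in at_top. 1 / real (m n) * ln (real (m n) * ?\<mu> n) = ln (saddle_point n (\<alpha> n))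
      \<and> ln (saddle_point n (\<alpha> n)) = 1 / \<alpha> n * (ln (real n / \<alpha> n) + ln (ln (real n / \<alpha> n)) + ?r n)"
    using eventually_ge_at_top[of 1]
  proof eventually_elim
    case (elim n)
    have "m n \<ge> 1" using assms(6)[OF elim] by blast
    moreover have "saddle_point n (\<alpha> n) > 0" by (rule saddle_point_properties[OF elim \<alpha>_ge_1[OF elim]])
    ultimately show ?case
      using \<alpha>_ge_1[OF elim] by (simp add: cycle_mean_def ln_realpow)
  qed
qed

end
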